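(* Let $0<\delta<1/800$, $\lambda\in\mathbb{R}$ and $n\in\mathbb{N}$. Let $\mathcal{C}_1$ be the largest component of $D(n,p)$ for $p=n^{-1}+\lambda n^{-4/3}$. If $n$ is sufficiently large with respect to $\delta$ and $\lambda$, then $$\mathbb{P}\left(|\mathcal{C}_1|<\delta n^{1/3}\right)\le 2e\,\delta^{1/4},$$ provided that $\delta\le \frac{(\log 2)^2}{4|\lambda|^2}$ (a condition which is vacuous when $\lambda=0$).
   Context: $D(n,p)$ is the random digraph on vertex set $[n]=\{1,\dots,n\}$ in which each of the $n(n-1)$ possible directed edges (ordered pairs of distinct vertices) is included with probability $p$ independently of all others. "Component" means strongly connected component; $|\mathcal{C}_1|$ is the number of vertices of a largest strongly connected component. A single vertex counts as a strongly connected digraph. *)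

theory Defs
  imports "HOL-Probability.Probability" "Graph_Theory.Digraph_Component"
begin

definition possible_arcs :: "nat \<Rightarrow> (nat \<times> nat) set" where
  "possible_arcs n = {(u, v). u \<in> {1..n} \<and> v \<in> {1..n} \<and> u \<noteq> v}"

text \<open>
  The random digraph D(n,p): the product measure of Bernoulli(p) indicators, one per possible arc,
  pushed forward to the digraph they describe. The parameter \<open>p\<close> is meant to lie in
  the unit interval (\<open>bernoulli_pmf\<close> clamps other values to it).
\<close>

definition random_digraph :: "nat \<Rightarrow> real \<Rightarrow> nat pair_pre_digraph pmf" where
  "random_digraph n p =
     map_pmf (\<lambda>X. \<lparr>pverts = {1..n}, parcs = {a \<in> possible_arcs n. X a}\<rparr>)
       (Pi_pmf (possible_arcs n) False (\<lambda>_. bernoulli_pmf p))"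

text \<open>
  The value is meaningful for finite digraphs with at least one vertex, where the set of strongly
  connected components is finite and nonempty.
\<close>

definition largest_scc_size :: "('a, 'b) pre_digraph \<Rightarrow> nat" where
  "largest_scc_size G = Max ((\<lambda>C. card (verts C)) ` pre_digraph.sccs G)"

end

theory Submission
  imports Defs "HOL-Real_Asymp.Real_Asymp"
begin

text \<open>
  A directed cycle of length \<open>k\<close> forces a strong component with at least \<open>k\<close> vertices, so it suffices to bound
  the probability that no directed cycle has its length between \<open>\<delta> n^(1/3)\<close> and \<open>sqrt \<delta> n^(1/3)\<close>. The condition
  on \<open>\<delta>\<close> keeps \<open>(n p)^k\<close> above 13/20 on this range, so the expected number of these cycles is at least about 3/5
  times the harmonic sum over it, which is close to \<open>ln (1/\<delta>) / 2\<close>. Given one such cycle, the expected number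
  of others meeting it is of order \<open>\<delta>^(3/2)\<close>, so Janson's inequality bounds the probability by \<open>exp\<close> of almost
  minus the expectation, and the resulting exponent of \<open>\<delta>\<close>, about 3/10, exceeds 1/4.
\<close>

subsection \<open>Janson's inequality\<close>

lemma prob_bernoulli_bind:
  assumes "0 \<le> p" "p \<le> 1"
  shows "measure_pmf.prob (bernoulli_pmf p \<bind> g) S =
    p * measure_pmf.prob (g True) S + (1 - p) * measure_pmf.prob (g False) S"
proof -
  have "ennreal (measure_pmf.prob (bernoulli_pmf p \<bind> g) S) = emeasure (measure_pmf (bernoulli_pmf p \<bind> g)) S"
    by (simp add: measure_pmf.emeasure_eq_measure)
  also have "\<dots> = ennreal p * ennreal (measure_pmf.prob (g True) S)
      + ennreal (1 - p) * ennreal (measure_pmf.prob (g False) S)"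
    using assms by (simp only: emeasure_bind_pmf nn_integral_bernoulli_pmf zero_le) (simp add: measure_pmf.emeasure_eq_measure mult.commute)
  also have "\<dots> = ennreal (p * measure_pmf.prob (g True) S + (1 - p) * measure_pmf.prob (g False) S)"
    using assms by (simp add: ennreal_mult ennreal_plus)
  finally show ?thesis
    using assms by (subst (asm) ennreal_inj) auto
qed

text \<open>Once coordinate \<open>a\<close> is overwritten, the event no longer depends on it, so
  both conditional probabilities can be measured under \<open>M\<close> again instead of the product
  over \<open>A - {a}\<close>. This keeps the measure fixed and lets the identity be
  iterated.\<close>

lemma prob_Pi_bernoulli:
  assumes "finite A" "a \<in> A" "0 \<le> p" "p \<le> 1"
  defines "M \<equiv> Pi_pmf A False (\<lambda>_. bernoulli_pmf p)"
  shows "measure_pmf.prob M {X. P X} =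
    p * measure_pmf.prob M {X. P (X(a := True))} + (1 - p) * measure_pmf.prob M {X. P (X(a := False))}"
proof -
  define M' where "M' = Pi_pmf (A - {a}) False (\<lambda>_. bernoulli_pmf p)"
  have "A = insert a (A - {a})"
    using assms by auto
  hence M: "M = bernoulli_pmf p \<bind> (\<lambda>y. map_pmf (\<lambda>X. X(a := y)) M')"
    unfolding M_def M'_def
    by (subst Pi_pmf_insert'[symmetric, folded map_pmf_def]) (use assms in \<open>auto simp: map_pmf_def\<close>)
  have cond: "measure_pmf.prob M {X. Q X} =
      p * measure_pmf.prob M' {X. Q (X(a := True))} + (1 - p) * measure_pmf.prob M' {X. Q (X(a := False))}" for Q
    unfolding M using assms by (simp add: prob_bernoulli_bind vimage_def)
  show ?thesis
    unfolding cond[of P] cond[of "\<lambda>X. P (X(a := True))"] cond[of "\<lambda>X. P (X(a := False))"]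
    by (simp add: algebra_simps)
qed

text \<open>By independence, conditioning on the coordinates in \<open>T\<close> being true is the
  same as forcing them to be true. \<open>P\<close> is arbitrary in the induction because each
  forced coordinate is absorbed into the predicate.\<close>

lemma prob_Pi_bernoulli_all_True:
  assumes "finite A" "T \<subseteq> A" "0 \<le> p" "p \<le> 1"
  defines "M \<equiv> Pi_pmf A False (\<lambda>_. bernoulli_pmf p)"
  shows "measure_pmf.prob M {X. (\<forall>a\<in>T. X a) \<and> P X} =
    p ^ card T * measure_pmf.prob M {X. P (\<lambda>a. a \<in> T \<or> X a)}"
proof -
  have "finite T"
    using assms finite_subset by blast
  thus ?thesis
    using \<open>T \<subseteq> A\<close>
  proof (induction T arbitrary: P)
    case empty
    show ?case by simp
  next
    case (insert t T)
    have True_eq: "(\<forall>a\<in>insert t T. (X(t := True)) a) \<longleftrightarrow> (\<forall>a\<in>T. X a)" for X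
      using insert.hyps by auto
    have False_eq: "(\<forall>a\<in>insert t T. (X(t := False)) a) \<longleftrightarrow> False" for X
      by auto
    have "measure_pmf.prob M {X. (\<forall>a\<in>insert t T. X a) \<and> P X} =
        p * measure_pmf.prob M {X. (\<forall>a\<in>T. X a) \<and> P (X(t := True))}"
      using prob_Pi_bernoulli[of A t p "\<lambda>X. (\<forall>a\<in>insert t T. X a) \<and> P X"] insert.prems assms
      unfolding M_def True_eq False_eq by simp
    also have "\<dots> = p ^ card (insert t T) * measure_pmf.prob M {X. P ((\<lambda>X. (\<lambda>a. a \<in> T \<or> X a)(t := True)) X)}"
      using insert by simp
    also have "(\<lambda>X. (\<lambda>a. a \<in> T \<or> X a)(t := True)) = (\<lambda>X a. a \<in> insert t T \<or> X a)"
      by (auto simp: fun_eq_iff)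
    finally show ?case .
  qed
qed

text \<open>
  The induction adds one member \<open>F\<close> of \<open>\<F>\<close> at a time. Conditioning on \<open>F\<close> being fully present does not
  affect the members disjoint from \<open>F\<close>, and those meeting \<open>F\<close> are handled by a union bound, in which
  the decreasing event that the former are all absent only becomes less likely once \<open>F \<union> F'\<close> is present.
\<close>
lemma Janson_inequality:
  fixes p \<epsilon> :: real and A :: "'a set"
  assumes A: "finite A" and p: "0 \<le> p" "p \<le> 1" and "finite \<F>" "\<And>F. F \<in> \<F> \<Longrightarrow> F \<subseteq> A"
    and "\<And>F. F \<in> \<F> \<Longrightarrow> (\<Sum>F'\<in>{F'\<in>\<F>. F' \<noteq> F \<and> F' \<inter> F \<noteq> {}}. p ^ card (F \<union> F')) \<le> \<epsilon> * p ^ card F"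
  defines "M \<equiv> Pi_pmf A False (\<lambda>_. bernoulli_pmf p)"
  shows "measure_pmf.prob M {X. \<forall>F\<in>\<F>. \<not> (\<forall>a\<in>F. X a)} \<le> exp (- (1 - \<epsilon>) * (\<Sum>F\<in>\<F>. p ^ card F))"
  using assms(4-6)
proof (induction \<F>)
  case empty
  show ?case by simp
next
  case (insert F \<F>)
  define absent where "absent = (\<lambda>\<G> (X :: 'a \<Rightarrow> bool). \<forall>F\<in>\<G>. \<not> (\<forall>a\<in>F. X a))"
  define \<N> where "\<N> = {F'\<in>\<F>. F' \<noteq> F \<and> F' \<inter> F \<noteq> {}}"
  define \<D> where "\<D> = {F'\<in>\<F>. F' \<inter> F = {}}"
  have FF: "\<F> = \<N> \<union> \<D>"
    using insert by (auto simp: \<N>_def \<D>_def)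
  have [simp]: "finite \<N>"
    using insert by (simp add: \<N>_def)
  have sub: "F \<subseteq> A" "\<And>F'. F' \<in> \<F> \<Longrightarrow> F' \<subseteq> A"
    using insert by auto
  let ?P = "\<lambda>Q. measure_pmf.prob M {X. Q X}"
  have "(\<Sum>F'\<in>\<N>. p ^ card (F \<union> F')) \<le> (\<Sum>F'\<in>{F'\<in>insert F \<F>. F' \<noteq> F \<and> F' \<inter> F \<noteq> {}}. p ^ card (F \<union> F'))"
    using p insert by (intro sum_mono2) (auto simp: \<N>_def)
  also have "\<dots> \<le> \<epsilon> * p ^ card F"
    by (intro insert) auto
  finally have eps: "(\<Sum>F'\<in>\<N>. p ^ card (F \<union> F')) \<le> \<epsilon> * p ^ card F" .
  have IH: "?P (absent \<F>) \<le> exp (- (1 - \<epsilon>) * (\<Sum>F\<in>\<F>. p ^ card F))"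
    unfolding absent_def
  proof (rule insert.IH)
    fix F' assume F': "F' \<in> \<F>"
    have "(\<Sum>F''\<in>{F''\<in>\<F>. F'' \<noteq> F' \<and> F'' \<inter> F' \<noteq> {}}. p ^ card (F' \<union> F''))
      \<le> (\<Sum>F''\<in>{F''\<in>insert F \<F>. F'' \<noteq> F' \<and> F'' \<inter> F' \<noteq> {}}. p ^ card (F' \<union> F''))"
      using p insert by (intro sum_mono2) auto
    also have "\<dots> \<le> \<epsilon> * p ^ card F'"
      using F' by (intro insert) auto
    finally show "(\<Sum>F''\<in>{F''\<in>\<F>. F'' \<noteq> F' \<and> F'' \<inter> F' \<noteq> {}}. p ^ card (F' \<union> F'')) \<le> \<epsilon> * p ^ card F'" .
  qed (use insert in auto)
  have indep: "?P (\<lambda>X. (\<forall>a\<in>F. X a) \<and> absent \<D> X) = p ^ card F * ?P (absent \<D>)"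
  proof -
    have "absent \<D> (\<lambda>a. a \<in> F \<or> X a) = absent \<D> X" for X
      by (auto simp: absent_def \<D>_def)
    thus ?thesis
      unfolding M_def by (subst prob_Pi_bernoulli_all_True) (use A p sub in auto)
  qed
  have neg_corr: "?P (\<lambda>X. (\<forall>a\<in>F \<union> F'. X a) \<and> absent \<D> X) \<le> p ^ card (F \<union> F') * ?P (absent \<D>)"
    if "F' \<in> \<N>" for F'
  proof -
    have "?P (\<lambda>X. absent \<D> (\<lambda>a. a \<in> F \<union> F' \<or> X a)) \<le> ?P (absent \<D>)"
      by (rule measure_pmf.finite_measure_mono) (auto simp: absent_def)
    thus ?thesis
      unfolding M_def by (subst prob_Pi_bernoulli_all_True)
        (use A p sub that in \<open>auto simp: \<N>_def intro: mult_left_mono\<close>)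
  qed
  \<comment> \<open>If \<open>F\<close> is present and all of \<open>\<D>\<close> is absent, then
    either all of \<open>\<F>\<close> is absent or some neighbour in \<open>\<N>\<close> is present
    together with \<open>F\<close>.\<close>
  have "?P (\<lambda>X. (\<forall>a\<in>F. X a) \<and> absent \<D> X)
      \<le> measure_pmf.prob M ({X. (\<forall>a\<in>F. X a) \<and> absent \<F> X} \<union> (\<Union>F'\<in>\<N>. {X. (\<forall>a\<in>F \<union> F'. X a) \<and> absent \<D> X}))"
    by (rule measure_pmf.finite_measure_mono) (auto simp: FF absent_def)
  also have "\<dots> \<le> ?P (\<lambda>X. (\<forall>a\<in>F. X a) \<and> absent \<F> X) + (\<Sum>F'\<in>\<N>. ?P (\<lambda>X. (\<forall>a\<in>F \<union> F'. X a) \<and> absent \<D> X))"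
    by (intro order.trans[OF measure_Un_le] add_mono measure_UNION_le) auto
  also have "(\<Sum>F'\<in>\<N>. ?P (\<lambda>X. (\<forall>a\<in>F \<union> F'. X a) \<and> absent \<D> X)) \<le> (\<Sum>F'\<in>\<N>. p ^ card (F \<union> F') * ?P (absent \<D>))"
    by (intro sum_mono neg_corr)
  also have "\<dots> = (\<Sum>F'\<in>\<N>. p ^ card (F \<union> F')) * ?P (absent \<D>)"
    by (simp add: sum_distrib_right)
  also have "\<dots> \<le> \<epsilon> * p ^ card F * ?P (absent \<D>)"
    using eps by (intro mult_right_mono) auto
  finally have lower: "(1 - \<epsilon>) * p ^ card F * ?P (absent \<D>) \<le> ?P (\<lambda>X. (\<forall>a\<in>F. X a) \<and> absent \<F> X)"
    unfolding indep by (simp add: algebra_simps)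
  have "(1 - \<epsilon>) * p ^ card F * ?P (absent \<F>) \<le> ?P (\<lambda>X. (\<forall>a\<in>F. X a) \<and> absent \<F> X)"
  \<comment> \<open>Replacing \<open>\<D>\<close> by the larger family \<open>\<F>\<close> needs the
    factor \<open>1 - \<epsilon>\<close> to be nonnegative; otherwise the left side is at most
    0.\<close>
  proof (cases "\<epsilon> \<le> 1")
    case True
    have "?P (absent \<F>) \<le> ?P (absent \<D>)"
      by (rule measure_pmf.finite_measure_mono) (auto simp: FF absent_def)
    hence "(1 - \<epsilon>) * p ^ card F * ?P (absent \<F>) \<le> (1 - \<epsilon>) * p ^ card F * ?P (absent \<D>)"
      using True p by (intro mult_left_mono) auto
    thus ?thesis using lower by linarith
  next
    case False
    have "(1 - \<epsilon>) * p ^ card F * ?P (absent \<F>) \<le> 0"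
      using False p by (intro mult_nonpos_nonneg) auto
    also have "0 \<le> ?P (\<lambda>X. (\<forall>a\<in>F. X a) \<and> absent \<F> X)"
      by simp
    finally show ?thesis .
  qed
  moreover have "?P (absent \<F>) = ?P (\<lambda>X. (\<forall>a\<in>F. X a) \<and> absent \<F> X) + ?P (absent (insert F \<F>))"
    by (subst measure_pmf.finite_measure_Union[symmetric])
       (auto simp: absent_def intro!: arg_cong[where f = "measure_pmf.prob _"])
  ultimately have "?P (absent (insert F \<F>)) \<le> (1 - (1 - \<epsilon>) * p ^ card F) * ?P (absent \<F>)"
    by (simp add: algebra_simps)
  also have "\<dots> \<le> exp (- (1 - \<epsilon>) * p ^ card F) * ?P (absent \<F>)"
    using exp_ge_add_one_self[of "- (1 - \<epsilon>) * p ^ card F"] by (intro mult_right_mono) (auto simp: algebra_simps)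
  also have "\<dots> \<le> exp (- (1 - \<epsilon>) * p ^ card F) * exp (- (1 - \<epsilon>) * (\<Sum>F\<in>\<F>. p ^ card F))"
    using IH by (intro mult_left_mono) auto
  also have "\<dots> = exp (- (1 - \<epsilon>) * (\<Sum>F\<in>insert F \<F>. p ^ card F))"
    using insert by (simp add: exp_add[symmetric] algebra_simps)
  finally show ?case
    by (simp add: absent_def)
qed

subsection \<open>Directed cycles as arc sets\<close>

definition cycle_arcs :: "'a list \<Rightarrow> ('a \<times> 'a) set" where
  "cycle_arcs xs = set (zip xs (rotate1 xs))"

text \<open>Arc sets rather than lists: rotations of a list are then counted once, and each cycle is
  a set of Bernoulli coordinates, as Janson's inequality requires.\<close>

definition cycles :: "'a set \<Rightarrow> nat \<Rightarrow> ('a \<times> 'a) set set" where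
  "cycles V k = cycle_arcs ` {xs. length xs = k \<and> distinct xs \<and> set xs \<subseteq> V}"

lemma finite_cycle_arcs [simp]: "finite (cycle_arcs xs)"
  by (simp add: cycle_arcs_def)

lemma cycle_arcs_Cons: "cycle_arcs (x # xs) = set (zip (x # xs) (xs @ [x]))"
  by (simp add: cycle_arcs_def)

lemma cycle_arcs_conv_nth:
  "cycle_arcs xs = (\<lambda>i. (xs ! i, xs ! (Suc i mod length xs))) ` {..<length xs}"
  by (auto simp: cycle_arcs_def set_zip nth_rotate1 image_iff)

lemma cycle_arcsD: "(u, v) \<in> cycle_arcs xs \<Longrightarrow> u \<in> set xs \<and> v \<in> set xs"
  unfolding cycle_arcs_def by (metis set_rotate1 set_zip_leftD set_zip_rightD)

lemma cycle_arcs_ex: "u \<in> set xs \<Longrightarrow> \<exists>v. (u, v) \<in> cycle_arcs xs"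
  by (auto simp: cycle_arcs_conv_nth in_set_conv_nth)

lemma cycle_arcs_rotate1: "cycle_arcs (rotate1 xs) = cycle_arcs xs"
proof (cases xs)
  case (Cons x ys)
  show ?thesis
  proof (cases ys)
    case (Cons y zs)
    have "zip ((y # zs) @ [x]) ((zs @ [x]) @ [y]) = zip (y # zs) (zs @ [x]) @ [(x, y)]"
      by (subst zip_append) auto
    thus ?thesis
      using \<open>xs = x # ys\<close> Cons by (auto simp: cycle_arcs_def)
  qed (simp add: Cons)
qed simp

lemma cycle_arcs_rotate: "cycle_arcs (rotate i xs) = cycle_arcs xs"
  by (induction i) (simp_all add: cycle_arcs_rotate1)

lemma card_cycle_arcs: "distinct xs \<Longrightarrow> card (cycle_arcs xs) = length xs"
  by (simp add: cycle_arcs_def distinct_card distinct_zipI1)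

lemma cycle_arcs_unique_head:
  assumes "distinct xs" "(u, v) \<in> cycle_arcs xs" "(u, v') \<in> cycle_arcs xs"
  shows "v = v'"
  using assms by (auto simp: cycle_arcs_conv_nth nth_eq_iff_index_eq)

lemma cycle_arcs_unique_tail:
  assumes "distinct xs" "(u, v) \<in> cycle_arcs xs" "(u', v) \<in> cycle_arcs xs"
  shows "u = u'"
proof -
  have "distinct (rotate1 xs)"
    using assms by simp
  thus ?thesis
    using assms(2,3) unfolding cycle_arcs_def set_zip
    by (auto simp: nth_eq_iff_index_eq)
qed

lemma cycle_subset_closed:
  assumes "x \<in> set xs" "x \<in> W" "\<And>u v. (u, v) \<in> cycle_arcs xs \<Longrightarrow> u \<in> W \<Longrightarrow> v \<in> W"
  shows "set xs \<subseteq> W"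
proof
  define n where "n = length xs"
  obtain i where i: "i < n" "xs ! i = x"
    using assms(1) by (auto simp: n_def in_set_conv_nth)
  hence "0 < n"
    by simp
  have step: "xs ! ((i + j) mod n) \<in> W" for j
  proof (induction j)
    case 0
    show ?case using i assms(2) by simp
  next
    case (Suc j)
    have "(xs ! ((i + j) mod n), xs ! (Suc ((i + j) mod n) mod n)) \<in> cycle_arcs xs"
      using \<open>0 < n\<close> unfolding cycle_arcs_conv_nth n_def by (intro imageI) simp
    with Suc assms(3) show ?case
      by (simp add: mod_Suc_eq)
  qed
  fix y assume "y \<in> set xs"
  then obtain m where m: "m < n" "xs ! m = y"
    by (auto simp: n_def in_set_conv_nth)
  \<comment> \<open>Walking \<open>n - i + m\<close> arcs from position \<open>i\<close> wraps
    around once and ends at position \<open>m\<close>.\<close>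
  have "(i + (n - i + m)) mod n = m"
    using i m by simp
  thus "y \<in> W"
    using step[of "n - i + m"] m by simp
qed

text \<open>Each vertex has only one outgoing arc, so the arcs determine the list entry by entry
  from its head. Hence at most \<open>k\<close> lists describe one cycle of length
  \<open>k\<close>.\<close>

lemma cycle_arcs_inject:
  assumes "distinct xs" "distinct ys" "cycle_arcs xs = cycle_arcs ys" "hd xs = hd ys"
  shows "xs = ys"
proof (rule nth_equalityI)
  show len: "length xs = length ys"
    using assms card_cycle_arcs by metis
  have "xs ! i = ys ! i" if "i < length xs" for i
    using that
  proof (induction i)
    case 0
    thus ?case using assms len by (metis hd_conv_nth list.size(3) less_nat_zero_code)
  next
    case (Suc i)
    have "(xs ! i, xs ! Suc i) \<in> cycle_arcs xs" "(ys ! i, ys ! Suc i) \<in> cycle_arcs ys"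
      using Suc.prems len by (auto simp: cycle_arcs_conv_nth image_iff intro!: bexI[of _ i])
    thus ?case
      using Suc assms by (metis Suc_lessD cycle_arcs_unique_head)
  qed
  thus "\<And>i. i < length xs \<Longrightarrow> xs ! i = ys ! i" .
qed

text \<open>Otherwise \<open>ys\<close>, once on \<open>xs\<close>, would follow its arcs forever
  and stay on it. Uniqueness of outgoing arcs then makes \<open>xs\<close> follow \<open>ys\<close>
  as well, and the two arc sets coincide.\<close>

lemma cycle_leaves_other_cycle:
  assumes "distinct xs" "distinct ys" "cycle_arcs ys \<noteq> cycle_arcs xs" "x \<in> set xs" "x \<in> set ys"
  shows "\<exists>u v. (u, v) \<in> cycle_arcs ys \<and> u \<in> set xs \<and> (u, v) \<notin> cycle_arcs xs"
proof (rule ccontr)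
  assume "\<not> ?thesis"
  hence *: "\<And>u v. (u, v) \<in> cycle_arcs ys \<Longrightarrow> u \<in> set xs \<Longrightarrow> (u, v) \<in> cycle_arcs xs"
    by blast
  have ys_xs: "set ys \<subseteq> set xs"
    by (rule cycle_subset_closed[OF assms(5,4)]) (use * in \<open>blast dest: cycle_arcsD\<close>)
  have head: "(u, v) \<in> cycle_arcs ys" if "(u, v) \<in> cycle_arcs xs" "u \<in> set ys" for u v
  proof -
    obtain v' where "(u, v') \<in> cycle_arcs ys"
      using cycle_arcs_ex[OF \<open>u \<in> set ys\<close>] by blast
    moreover from this have "(u, v') \<in> cycle_arcs xs"
      using * ys_xs that(2) by blast
    ultimately show ?thesis
      using cycle_arcs_unique_head[OF assms(1) that(1)] by blast
  qed
  have "set xs \<subseteq> set ys"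
    by (rule cycle_subset_closed[OF assms(4,5)]) (use head in \<open>blast dest: cycle_arcsD\<close>)
  have "cycle_arcs ys \<subseteq> cycle_arcs xs"
    using * ys_xs by (intro subrelI) (blast dest: cycle_arcsD)
  moreover have "cycle_arcs xs \<subseteq> cycle_arcs ys"
    using head \<open>set xs \<subseteq> set ys\<close> by (intro subrelI) (blast dest: cycle_arcsD)
  ultimately show False
    using assms(3) by blast
qed

lemma cycle_arcs_start_at:
  assumes "(u, v) \<in> cycle_arcs xs" "distinct xs" "2 \<le> length xs"
  obtains zs where "cycle_arcs (u # v # zs) = cycle_arcs xs" "distinct (u # v # zs)"
    "set (u # v # zs) = set xs"
proof -
  obtain i where i: "i < length xs" "u = xs ! i"
    using assms(1) by (auto simp: cycle_arcs_conv_nth)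
  define ys where "ys = rotate i xs"
  have "xs \<noteq> []"
    using assms(3) by auto
  hence ys: "cycle_arcs ys = cycle_arcs xs" "distinct ys" "set ys = set xs" "length ys = length xs" "hd ys = u"
    using i assms by (simp_all add: ys_def cycle_arcs_rotate hd_rotate_conv_nth)
  have "Suc (Suc 0) \<le> length ys"
    using ys(4) assms(3) by simp
  then obtain u' y zs where "ys = u' # y # zs"
    by (auto simp: Suc_le_length_iff)
  hence zs: "ys = u # y # zs"
    using ys(5) by simp
  hence "(u, y) \<in> cycle_arcs ys"
    by (simp add: cycle_arcs_Cons)
  hence "y = v"
    using cycle_arcs_unique_head[OF assms(2,1)] ys(1) by blast
  show ?thesis
    using that[of zs] ys zs \<open>y = v\<close> by simp
qed

section \<open>Counting the cycles of a given length\<close>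

lemma finite_cycles: "finite V \<Longrightarrow> finite (cycles V k)"
  unfolding cycles_def
  by (intro finite_imageI finite_subset[OF _ finite_lists_length_eq[of V k]]) auto

text \<open>The product counts the distinct lists of length \<open>k\<close>. A list is determined
  by its arc set and its head, and the head is one of the \<open>k\<close> vertices of the cycle, so
  every fibre of \<open>cycle_arcs\<close> has at most \<open>k\<close> elements.\<close>

lemma card_cycles_ge:
  assumes "finite V" "0 < k" "k \<le> card V"
  shows "\<Prod>{card V - k + 1..card V} \<le> k * card (cycles V k)"
proof -
  define L where "L = {xs. length xs = k \<and> distinct xs \<and> set xs \<subseteq> V}"
  have "finite L"
    unfolding L_def by (intro finite_subset[OF _ finite_lists_length_eq[OF assms(1), of k]]) auto
  have "L = (\<Union>F\<in>cycles V k. {xs\<in>L. cycle_arcs xs = F})"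
    by (auto simp: cycles_def L_def)
  hence "card L \<le> (\<Sum>F\<in>cycles V k. card {xs\<in>L. cycle_arcs xs = F})"
    using card_UN_le[OF finite_cycles[OF assms(1)]] by metis
  also have "\<dots> \<le> (\<Sum>F\<in>cycles V k. k)"
  proof (rule sum_mono)
    fix F assume "F \<in> cycles V k"
    then obtain xs where xs: "xs \<in> L" "F = cycle_arcs xs"
      by (auto simp: cycles_def L_def)
    show "card {xs\<in>L. cycle_arcs xs = F} \<le> k"
    proof -
      have "inj_on hd {xs\<in>L. cycle_arcs xs = F}"
        by (intro inj_onI cycle_arcs_inject) (auto simp: L_def)
      moreover have "hd ` {xs\<in>L. cycle_arcs xs = F} \<subseteq> set xs"
      proof clarify
        fix ys assume "ys \<in> L" "F = cycle_arcs ys"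
        moreover from this have "(hd ys, ys ! (Suc 0 mod length ys)) \<in> cycle_arcs ys"
          using assms(2) by (auto simp: L_def cycle_arcs_conv_nth hd_conv_nth image_iff intro!: bexI[of _ 0])
        ultimately show "hd ys \<in> set xs"
          using xs cycle_arcsD by metis
      qed
      ultimately have "card {xs\<in>L. cycle_arcs xs = F} \<le> card (set xs)"
        by (metis (lifting) List.finite_set card_inj_on_le)
      thus ?thesis
        using xs by (simp add: L_def distinct_card)
    qed
  qed
  finally show ?thesis
    using card_lists_distinct_length_eq[OF assms(1,3)] by (simp add: L_def mult.commute)
qed

section \<open>Weighted walks and the cycles that meet a fixed cycle\<close>

primrec walk_sum :: "('a \<times> 'a \<Rightarrow> real) \<Rightarrow> 'a set \<Rightarrow> nat \<Rightarrow> 'a \<Rightarrow> 'a \<Rightarrow> real" where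
  "walk_sum w V 0 x z = w (x, z)"
| "walk_sum w V (Suc j) x z = (\<Sum>y\<in>V. w (x, y) * walk_sum w V j y z)"

text \<open>Here \<open>j\<close> counts inner vertices, so the walks have \<open>j + 1\<close>
  arcs. Repeated vertices are allowed: the sum is an entry of a power of the weight matrix when
  \<open>x\<close> and \<open>z\<close> lie in \<open>V\<close>, and it can only overcount
  cycles.\<close>

lemma walk_sum_conv_lists:
  "walk_sum w V j x z =
    (\<Sum>zs | length zs = j \<and> set zs \<subseteq> V. prod_list (map w (zip (x # zs) (zs @ [z]))))"
proof (induction j arbitrary: x)
  case 0
  have "{zs. length zs = 0 \<and> set zs \<subseteq> V} = {[]}"
    by auto
  thus ?case by simp
next
  case (Suc j)
  have "walk_sum w V (Suc j) x z = (\<Sum>(y, zs)\<in>V \<times> {zs. length zs = j \<and> set zs \<subseteq> V}.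
      w (x, y) * prod_list (map w (zip (y # zs) (zs @ [z]))))"
    by (simp add: Suc sum_distrib_left sum.cartesian_product)
  also have "\<dots> = (\<Sum>zs | length zs = Suc j \<and> set zs \<subseteq> V. prod_list (map w (zip (x # zs) (zs @ [z]))))"
    by (rule sum.reindex_bij_witness[of _ "\<lambda>zs. (hd zs, tl zs)" "\<lambda>(y, zs). y # zs"])
       (auto simp: length_Suc_conv)
  finally show ?case .
qed

lemma walk_sum_nonneg: "(\<And>a. 0 \<le> w a) \<Longrightarrow> 0 \<le> walk_sum w V j x z"
  by (induction j arbitrary: x) (auto intro!: sum_nonneg)

text \<open>
  Splitting the walks ending at \<open>z\<close> by whether they start on the cycle (\<open>S\<close>) or off it (\<open>T\<close>) gives a linear
  recursion. A walk off the cycle steps back to each of its vertices only with weight \<open>p\<close>, so as long as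
  \<open>K ^ 3 * p\<close> is small, \<open>S\<close> stays bounded and \<open>T\<close> grows linearly.
\<close>
lemma walk_sum_cycle_bound:
  fixes p c :: real and xs :: "'a list"
  assumes "finite V" "distinct xs" "set xs \<subseteq> V" "length xs \<le> K" "z \<in> set xs"
    and p: "0 \<le> p" "p \<le> 1" and c: "real (card V) * p \<le> c" "1 \<le> c" "c ^ K \<le> 2"
    and small: "6 * real K ^ 3 * p \<le> 1" and j: "j < K"
  defines "w \<equiv> \<lambda>a. if a \<in> cycle_arcs xs then 1 else p"
  shows "(\<Sum>x\<in>V. walk_sum w V j x z) \<le> 6 * real K"
proof -
  define U where "U = set xs"
  define k where "k = real (length xs)"
  define S where "S = (\<lambda>j. \<Sum>x\<in>U. walk_sum w V j x z)"
  define T where "T = (\<lambda>j. \<Sum>x\<in>V - U. walk_sum w V j x z)"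
  have U: "finite U" "U \<subseteq> V" "real (card U) = k"
    using assms by (auto simp: U_def k_def distinct_card)
  have w: "0 \<le> w a" for a
    using p by (simp add: w_def)
  have k: "0 \<le> k" "k \<le> K"
    using assms by (auto simp: k_def)
  have total: "(\<Sum>x\<in>V. walk_sum w V j x z) = S j + T j" for j
    using U assms(1) by (simp add: S_def T_def sum.subset_diff add.commute)
  \<comment> \<open>At most one arc of the cycle enters \<open>y\<close>, and only if
    \<open>y\<close> is on the cycle; all other arcs weigh \<open>p\<close>.\<close>
  have in_U: "(\<Sum>x\<in>U. w (x, y)) \<le> k * p + of_bool (y \<in> U)" for y
  proof -
    have "(\<Sum>x\<in>U. w (x, y)) \<le> (\<Sum>x\<in>U. p + of_bool ((x, y) \<in> cycle_arcs xs))"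
      using p by (intro sum_mono) (auto simp: w_def)
    also have "\<dots> = k * p + real (card {x\<in>U. (x, y) \<in> cycle_arcs xs})"
      using U by (simp add: sum.distrib Int_def)
    also have "card {x\<in>U. (x, y) \<in> cycle_arcs xs} \<le> of_bool (y \<in> U)"
    proof (cases "{x\<in>U. (x, y) \<in> cycle_arcs xs} = {}")
      case True
      show ?thesis
        unfolding True by simp
    next
      case False
      then obtain x where x: "(x, y) \<in> cycle_arcs xs"
        by auto
      hence "{x\<in>U. (x, y) \<in> cycle_arcs xs} \<subseteq> {x}"
        using cycle_arcs_unique_tail[OF assms(2)] by blast
      hence "card {x\<in>U. (x, y) \<in> cycle_arcs xs} \<le> card {x}"
        by (intro card_mono) auto
      moreover have "y \<in> U"
        using x by (auto simp: U_def dest: cycle_arcsD)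
      ultimately show ?thesis by simp
    qed
    finally show ?thesis by simp
  qed
  have out_U: "(\<Sum>x\<in>V - U. w (x, y)) \<le> c" for y
  proof -
    have "(\<Sum>x\<in>V - U. w (x, y)) = (\<Sum>x\<in>V - U. p)"
      by (intro sum.cong) (auto simp: w_def U_def dest: cycle_arcsD)
    also have "\<dots> \<le> real (card V) * p"
      using p assms(1) by (simp add: card_mono mult_right_mono)
    finally show ?thesis using c by simp
  qed
  have swap: "(\<Sum>x\<in>X. walk_sum w V (Suc j) x z) = (\<Sum>y\<in>V. (\<Sum>x\<in>X. w (x, y)) * walk_sum w V j y z)" for X j
    by (simp add: sum_distrib_right) (rule sum.swap)
  have S_Suc: "S (Suc j) \<le> S j + k * p * (S j + T j)" for j
  proof -
    have "S (Suc j) \<le> (\<Sum>y\<in>V. (k * p + of_bool (y \<in> U)) * walk_sum w V j y z)"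
      unfolding S_def swap using in_U by (intro sum_mono mult_right_mono walk_sum_nonneg w) auto
    also have "\<dots> = k * p * (\<Sum>y\<in>V. walk_sum w V j y z) + (\<Sum>y\<in>V. of_bool (y \<in> U) * walk_sum w V j y z)"
      by (simp add: sum_distrib_left distrib_right sum.distrib)
    also have "(\<Sum>y\<in>V. of_bool (y \<in> U) * walk_sum w V j y z) = S j"
      unfolding S_def using U assms(1) by (intro sum.mono_neutral_cong_right) auto
    finally show ?thesis
      by (simp add: total)
  qed
  have T_Suc: "T (Suc j) \<le> c * (S j + T j)" for j
  proof -
    have "T (Suc j) \<le> (\<Sum>y\<in>V. c * walk_sum w V j y z)"
      unfolding T_def swap using out_U by (intro sum_mono mult_right_mono walk_sum_nonneg w) auto
    thus ?thesis
      by (simp add: sum_distrib_left[symmetric] total)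
  qed
  have pow: "c ^ i \<le> 2" "1 \<le> c ^ i" if "i \<le> K" for i
    using power_increasing[OF that c(2)] c by (auto simp: one_le_power)
  \<comment> \<open>The factor \<open>6 * real K\<close> bounds \<open>S j + T j\<close> in the
    step: the smallness assumption gives \<open>S j \<le> 2\<close>, and
    \<open>c ^ K \<le> 2\<close> gives \<open>T j \<le> 4 * (j + 1)\<close>.\<close>
  have bound: "S j \<le> 1 + real (Suc j) * (6 * real K * (k * p)) \<and> T j \<le> 2 * real (Suc j) * c ^ Suc j" if "j < K" for j
    using that
  proof (induction j)
    case 0
    have "k * p \<le> 6 * real K * (k * p)"
      using mult_right_mono[of 1 "6 * real K" "k * p"] 0 k p by simp
    moreover have "S 0 \<le> 1 + k * p"
      using in_U[of z] \<open>z \<in> set xs\<close> by (simp add: S_def U_def)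
    moreover have "T 0 \<le> c"
      using out_U[of z] by (simp add: T_def)
    ultimately show ?case
      using c by simp
  next
    case (Suc j)
    have IH: "S j \<le> 1 + real (Suc j) * (6 * real K * (k * p))" "T j \<le> 2 * real (Suc j) * c ^ Suc j"
      using Suc by auto
    have "real (Suc j) * (6 * real K * (k * p)) \<le> real K * (6 * real K * (real K * p))"
      using Suc.prems k p by (intro mult_mono) auto
    also have "\<dots> \<le> 1"
      using small by (simp add: power3_eq_cube algebra_simps)
    finally have S2: "S j \<le> 2"
      using IH by simp
    have "T j \<le> 2 * real (Suc j) * 2"
      using Suc.prems by (intro order.trans[OF IH(2)] mult_left_mono pow(1)) auto
    hence "S j + T j \<le> 6 * real K"
      using S2 Suc.prems by simp
    hence "k * p * (S j + T j) \<le> 6 * real K * (k * p)"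
      using k p by (simp add: mult.commute mult_left_mono)
    hence "S (Suc j) \<le> 1 + real (Suc (Suc j)) * (6 * real K * (k * p))"
      using S_Suc[of j] IH(1) by (simp add: algebra_simps)
    moreover have "c * (S j + T j) \<le> c * (2 * c ^ Suc j + 2 * real (Suc j) * c ^ Suc j)"
      using S2 IH(2) pow[of "Suc j"] Suc.prems c by (intro mult_left_mono add_mono) auto
    ultimately show ?case
      using T_Suc[of j] by (simp add: algebra_simps)
  qed
  have "real (Suc j) * (6 * real K * (k * p)) \<le> real K * (6 * real K * (real K * p))"
    using j k p by (intro mult_mono) auto
  also have "\<dots> \<le> 1"
    using small by (simp add: power3_eq_cube algebra_simps)
  finally have "S j \<le> 2"
    using bound[OF j] by simp
  moreover have "T j \<le> 2 * real (Suc j) * 2"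
    using j by (intro order.trans[OF conjunct2[OF bound[OF j]]] mult_left_mono pow(1)) auto
  ultimately show ?thesis
    unfolding total using j by simp
qed

text \<open>
  A cycle other than \<open>F\<close> that meets \<open>F\<close> can be rotated so that it starts on \<open>F\<close> and its first arc leaves \<open>F\<close>.
  This leaves \<open>K\<close> choices of a start and \<open>K\<close> of a length, a factor \<open>p\<close> for the first arc, and a walk sum.
\<close>
lemma cycle_neighbour_sum:
  fixes p c :: real and V :: "'a set"
  assumes "finite V" and \<F>: "\<F> \<subseteq> (\<Union>k\<in>{2..K}. cycles V k)" and "F \<in> \<F>"
    and p: "0 \<le> p" "p \<le> 1" and c: "real (card V) * p \<le> c" "1 \<le> c" "c ^ K \<le> 2"
    and small: "6 * real K ^ 3 * p \<le> 1"
  shows "(\<Sum>F'\<in>{F'\<in>\<F>. F' \<noteq> F \<and> F' \<inter> F \<noteq> {}}. p ^ card (F \<union> F')) \<le> 6 * real K ^ 3 * p * p ^ card F"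
proof -
  \<comment> \<open>The product of these weights over \<open>F'\<close> is
    \<open>p ^ card (F' - F)\<close>, the probability of \<open>F'\<close> given that
    \<open>F\<close> is present.\<close>
  define w where "w = (\<lambda>a. if a \<in> F then 1 else p)"
  define \<N> where "\<N> = {F'\<in>\<F>. F' \<noteq> F \<and> F' \<inter> F \<noteq> {}}"
  have cycle: "\<exists>xs. distinct xs \<and> set xs \<subseteq> V \<and> 2 \<le> length xs \<and> length xs \<le> K \<and> F = cycle_arcs xs"
    if F: "F \<in> \<F>" for F
  proof -
    obtain k where "2 \<le> k" "k \<le> K" "F \<in> cycles V k"
      using subsetD[OF \<F> F] by auto
    thus ?thesis
      unfolding cycles_def by auto
  qed
  obtain xs where xs: "distinct xs" "set xs \<subseteq> V" "length xs \<le> K" "F = cycle_arcs xs"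
    using cycle[OF \<open>F \<in> \<F>\<close>] by blast
  \<comment> \<open>A neighbour is encoded as \<open>z # v # zs\<close>, with \<open>z\<close> on
    \<open>F\<close> and the arc from \<open>z\<close> to \<open>v\<close> not in \<open>F\<close>.
    It has \<open>j + 2\<close> vertices, hence \<open>j < K - 1\<close>.\<close>
  define I where "I = (SIGMA z:set xs. SIGMA j:{..<K - 1}. SIGMA v:V. {zs. length zs = j \<and> set zs \<subseteq> V})"
  define arcs where "arcs = (\<lambda>(z :: 'a, j :: nat, v, zs). cycle_arcs (z # v # zs))"
  define h where "h = (\<lambda>(z :: 'a, j :: nat, v, zs). p * prod_list (map w (zip (v # zs) (zs @ [z]))))"
  have w: "0 \<le> w a" for a
    using p by (simp add: w_def)
  have "\<exists>t. t \<in> I \<and> arcs t = F' \<and> p ^ card (F' - F) = h t" if F': "F' \<in> \<N>" for F'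
  proof -
    obtain ys where ys: "distinct ys" "set ys \<subseteq> V" "2 \<le> length ys" "length ys \<le> K" "F' = cycle_arcs ys"
      using F' cycle[of F'] unfolding \<N>_def by blast
    obtain a b where "(a, b) \<in> F'" "(a, b) \<in> F"
      using F' by (auto simp: \<N>_def)
    hence "a \<in> set xs" "a \<in> set ys"
      using xs ys by (auto dest: cycle_arcsD)
    then obtain z v where zv: "(z, v) \<in> F'" "z \<in> set xs" "(z, v) \<notin> F"
      using cycle_leaves_other_cycle[of xs ys a] xs ys F' by (auto simp: \<N>_def)
    obtain zs where zs: "cycle_arcs (z # v # zs) = F'" "distinct (z # v # zs)" "set (z # v # zs) = set ys"
      using cycle_arcs_start_at[of z v ys] zv(1) ys(1,3,5) by metis
    have "length (z # v # zs) = length ys"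
      using zs(2,3) ys(1) by (metis distinct_card)
    hence I: "(z, length zs, v, zs) \<in> I"
      using zs ys zv by (auto simp: I_def)
    have fin: "finite F'"
      using ys by simp
    have "p ^ card (F' - F) = (\<Prod>a\<in>F' - F. w a)"
      by (simp add: w_def)
    also have "\<dots> = (\<Prod>a\<in>F'. w a)"
      using fin by (intro prod.mono_neutral_left) (auto simp: w_def)
    also have "\<dots> = prod_list (map w (zip (z # v # zs) (v # zs @ [z])))"
      unfolding zs(1)[symmetric] cycle_arcs_Cons append_Cons
      by (rule prod.distinct_set_conv_list, rule distinct_zipI1) (fact zs(2))
    also have "\<dots> = h (z, length zs, v, zs)"
      using zv by (simp add: h_def w_def)
    finally show ?thesis
      using I zs(1) by (intro exI[of _ "(z, length zs, v, zs)"]) (simp add: arcs_def)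
  qed
  hence "\<forall>F'\<in>\<N>. \<exists>t. t \<in> I \<and> arcs t = F' \<and> p ^ card (F' - F) = h t"
    by blast
  then obtain s where s: "\<forall>F'\<in>\<N>. s F' \<in> I \<and> arcs (s F') = F' \<and> p ^ card (F' - F) = h (s F')"
    unfolding bchoice_iff by blast
  have fin: "finite {zs. length zs = j \<and> set zs \<subseteq> V}" for j
    using finite_lists_length_eq[OF assms(1), of j] by (rule rev_finite_subset) auto
  have "finite I"
    unfolding I_def using assms(1) fin by (intro finite_SigmaI) auto
  have "(\<Sum>F'\<in>\<N>. p ^ card (F' - F)) = (\<Sum>F'\<in>\<N>. h (s F'))"
    using s by (intro sum.cong) auto
  \<comment> \<open>The encoding \<open>s\<close> is injective because \<open>arcs\<close> recovers
    the cycle from its code.\<close>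
  also have "\<dots> = sum h (s ` \<N>)"
    using s by (intro sum.reindex[symmetric, unfolded comp_def] inj_on_inverseI[where g = arcs]) blast
  also have "\<dots> \<le> sum h I"
  proof (rule sum_mono2[OF \<open>finite I\<close>])
    show "s ` \<N> \<subseteq> I"
      using s by blast
    show "0 \<le> h t" for t
      using p w by (cases t) (auto simp: h_def intro!: mult_nonneg_nonneg prod_list_nonneg)
  qed
  also have "sum h I = (\<Sum>z\<in>set xs. \<Sum>j<K - 1. \<Sum>v\<in>V. \<Sum>zs | length zs = j \<and> set zs \<subseteq> V.
      p * prod_list (map w (zip (v # zs) (zs @ [z]))))"
    unfolding I_def h_def using assms(1) fin by (simp add: sum.Sigma[symmetric])
  also have "\<dots> = (\<Sum>z\<in>set xs. \<Sum>j<K - 1. p * (\<Sum>v\<in>V. walk_sum w V j v z))"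
    by (simp only: walk_sum_conv_lists sum_distrib_left)
  also have "\<dots> \<le> (\<Sum>z\<in>set xs. \<Sum>j<K - 1. p * (6 * real K))"
    unfolding w_def xs(4) using assms xs
    by (intro sum_mono mult_left_mono walk_sum_cycle_bound[where c = c]) auto
  also have "\<dots> = real (card (set xs)) * (real (K - 1) * (p * (6 * real K)))"
    by simp
  also have "\<dots> \<le> real K * (real K * (p * (6 * real K)))"
    using xs p by (intro mult_mono mult_right_mono) (auto simp: distinct_card)
  also have "\<dots> = 6 * real K ^ 3 * p"
    by (simp add: power3_eq_cube)
  finally have *: "(\<Sum>F'\<in>\<N>. p ^ card (F' - F)) \<le> 6 * real K ^ 3 * p" .
  have "(\<Sum>F'\<in>\<N>. p ^ card (F \<union> F')) = p ^ card F * (\<Sum>F'\<in>\<N>. p ^ card (F' - F))"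
    unfolding sum_distrib_left
  proof (rule sum.cong)
    fix F' assume "F' \<in> \<N>"
    hence "finite F'" "finite F"
      using cycle[of F'] xs by (auto simp: \<N>_def)
    hence "card (F \<union> F') = card F + card (F' - F)"
      by (subst Un_Diff_cancel[symmetric], subst card_Un_disjoint) auto
    thus "p ^ card (F \<union> F') = p ^ card F * p ^ card (F' - F)"
      by (simp add: power_add)
  qed simp
  also have "\<dots> \<le> p ^ card F * (6 * real K ^ 3 * p)"
    using * p by (intro mult_left_mono) auto
  finally show ?thesis
    by (simp add: \<N>_def mult_ac)
qed

section \<open>From directed cycles to strong components\<close>

lemma length_cycle_le_largest_scc_size:
  fixes G :: "'a pair_pre_digraph"
  assumes "finite (pverts G)" "parcs G \<subseteq> pverts G \<times> pverts G"
    and "distinct xs" "set xs \<subseteq> pverts G" "cycle_arcs xs \<subseteq> parcs G"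
  shows "length xs \<le> largest_scc_size (with_proj G)"
proof (cases xs)
  case (Cons x xs')
  interpret fin_digraph "with_proj G"
  proof
    fix e assume "e \<in> arcs (with_proj G)"
    thus "tail (with_proj G) e \<in> verts (with_proj G)" "head (with_proj G) e \<in> verts (with_proj G)"
      using assms(2) by auto
  next
    show "finite (verts (with_proj G))" "finite (arcs (with_proj G))"
      using assms(1) finite_subset[OF assms(2)] by simp_all
  qed
  \<comment> \<open>The set of vertices reachable from \<open>u\<close> is closed under the arcs of
    the cycle, so it contains the whole cycle.\<close>
  have reach: "u \<rightarrow>\<^sup>*\<^bsub>with_proj G\<^esub> v" if "u \<in> set xs" "v \<in> set xs" for u v
  proof -
    have "set xs \<subseteq> {v. u \<rightarrow>\<^sup>*\<^bsub>with_proj G\<^esub> v}"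
    proof (rule cycle_subset_closed[OF that(1)])
      show "u \<in> {v. u \<rightarrow>\<^sup>*\<^bsub>with_proj G\<^esub> v}"
        using that assms(4) by auto
    next
      fix a b assume "(a, b) \<in> cycle_arcs xs" "a \<in> {v. u \<rightarrow>\<^sup>*\<^bsub>with_proj G\<^esub> v}"
      moreover from this have "a \<rightarrow>\<^bsub>with_proj G\<^esub> b"
        using assms(5) by (auto simp: arcs_ends_def arc_to_ends_def)
      ultimately show "b \<in> {v. u \<rightarrow>\<^sup>*\<^bsub>with_proj G\<^esub> v}"
        by (auto intro: reachable_adj_trans)
    qed
    thus ?thesis using that by auto
  qed
  have "x \<in> set xs"
    using Cons by simp
  have "scc_of x \<in> verts ` sccs"
    unfolding sccs_verts_conv[symmetric] using assms(4) \<open>x \<in> set xs\<close> by (intro scc_of_in_sccs_verts) auto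
  then obtain H where H: "H \<in> sccs" "verts H = scc_of x"
    by auto
  have "set xs \<subseteq> scc_of x"
    using reach \<open>x \<in> set xs\<close> by (auto simp: scc_of_def)
  moreover have "scc_of x \<subseteq> pverts G"
    by (auto simp: scc_of_def dest: reachable_in_verts)
  ultimately have "length xs \<le> card (scc_of x)"
    using card_mono[OF finite_subset[OF _ assms(1)]] distinct_card[OF assms(3)] by metis
  also have "\<dots> \<le> Max ((\<lambda>C. card (verts C)) ` sccs)"
  proof (rule Max_ge)
    have "(\<lambda>C. card (verts C)) ` sccs = card ` sccs_verts"
      by (simp add: sccs_verts_conv image_image)
    thus "finite ((\<lambda>C. card (verts C)) ` sccs)"
      using finite_sccs_verts by simp
    show "card (scc_of x) \<in> (\<lambda>C. card (verts C)) ` sccs"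
      using imageI[OF H(1), of "\<lambda>C. card (verts C)"] unfolding H(2) .
  qed
  finally show ?thesis
    by (simp add: largest_scc_size_def)
qed simp

subsection \<open>The critical window\<close>

lemma cycle_arcs_subset_possible_arcs:
  assumes "distinct xs" "set xs \<subseteq> {1..n}" "2 \<le> length xs"
  shows "cycle_arcs xs \<subseteq> possible_arcs n"
proof (rule subrelI)
  fix u v assume uv: "(u, v) \<in> cycle_arcs xs"
  obtain zs where "distinct (u # v # zs)"
    using cycle_arcs_start_at[OF uv assms(1,3)] by metis
  thus "(u, v) \<in> possible_arcs n"
    using cycle_arcsD[OF uv] assms(2) by (auto simp: possible_arcs_def)
qed

text \<open>Each of the \<open>k\<close> factors is at least \<open>n - k\<close>, and Bernoulli's
  inequality bounds \<open>(1 - k / n) ^ k\<close> from below.\<close>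

lemma falling_prod_ge:
  assumes "k \<le> n"
  shows "real n ^ k * (1 - real k ^ 2 / real n) \<le> real (\<Prod>{n - k + 1..n})"
proof (cases "n = 0")
  case False
  have "1 + real k * (- (real k / real n)) \<le> (1 + - (real k / real n)) ^ k"
    using assms False by (intro Bernoulli_inequality) simp
  hence "real n ^ k * (1 - real k ^ 2 / real n) \<le> real n ^ k * (1 - real k / real n) ^ k"
    by (intro mult_left_mono) (auto simp: power2_eq_square)
  also have "\<dots> = (real n - real k) ^ k"
    unfolding power_mult_distrib[symmetric] using False by (simp add: right_diff_distrib)
  also have "\<dots> = (\<Prod>i\<in>{n - k + 1..n}. real n - real k)"
    using assms by simp
  also have "\<dots> \<le> (\<Prod>i\<in>{n - k + 1..n}. real i)"
    using assms by (intro prod_mono) auto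
  finally show ?thesis
    by simp
qed (use assms in simp)

text \<open>The bound telescopes from \<open>ln (k + 1) - ln k \<le> 1 / k\<close>. It also covers
  the empty range, where the left side is at most 0.\<close>

lemma harmonic_segment_ge:
  assumes "0 < a"
  shows "ln (real b + 1) - ln (real a) \<le> (\<Sum>k=a..b. 1 / real k)"
proof (cases "a \<le> b")
  case True
  thus ?thesis
  proof (induction b rule: dec_induct)
    case base
    show ?case
      using assms ln_diff_le[of "real a + 1" "real a"] by simp
  next
    case (step b)
    have "ln (real (Suc b) + 1) - ln (real (Suc b)) \<le> 1 / real (Suc b)"
      using ln_diff_le[of "real (Suc b) + 1" "real (Suc b)"] by simp
    with step show ?case
      by (simp add: add.commute)
  qed
next
  case False
  hence "ln (real b + 1) \<le> ln (real a)"
    by (subst ln_le_cancel_iff) auto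
  with False show ?thesis by simp
qed

text \<open>By the two counting bounds, the expected number of cycles of length \<open>k\<close> is
  at least \<open>\<beta> / k\<close>. Different lengths give disjoint families, so the
  contributions add up.\<close>

lemma cycle_weight_ge:
  fixes p \<beta> :: real
  assumes "0 \<le> p" "0 < a" "b \<le> n"
    and \<beta>: "\<And>k. k \<in> {a..b} \<Longrightarrow> \<beta> \<le> (real n * p) ^ k * (1 - real k ^ 2 / real n)"
  shows "\<beta> * (\<Sum>k=a..b. 1 / real k) \<le> (\<Sum>F\<in>(\<Union>k\<in>{a..b}. cycles {1..n} k). p ^ card F)"
proof -
  have card: "card F = k" if "F \<in> cycles {1..n} k" for F k
    using that by (auto simp: cycles_def card_cycle_arcs)
  have "\<beta> * (\<Sum>k=a..b. 1 / real k) \<le> (\<Sum>k=a..b. real (card (cycles {1..n} k)) * p ^ k)"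
    unfolding sum_distrib_left
  proof (rule sum_mono)
    fix k assume k: "k \<in> {a..b}"
    have "\<beta> \<le> (real n ^ k * (1 - real k ^ 2 / real n)) * p ^ k"
      using \<beta>[OF k] by (simp add: power_mult_distrib mult_ac)
    also have "\<dots> \<le> real (\<Prod>{n - k + 1..n}) * p ^ k"
      using k assms by (intro mult_right_mono falling_prod_ge) auto
    also have "\<dots> \<le> real (k * card (cycles {1..n} k)) * p ^ k"
      using card_cycles_ge[of "{1..n}" k] k assms
      by (intro mult_right_mono) (simp_all only: of_nat_le_iff, auto)
    finally show "\<beta> * (1 / real k) \<le> real (card (cycles {1..n} k)) * p ^ k"
      using k assms by (simp add: field_simps)
  qed
  also have "\<dots> = (\<Sum>k=a..b. \<Sum>F\<in>cycles {1..n} k. p ^ card F)"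
    by (simp add: card)
  also have "\<dots> = (\<Sum>F\<in>(\<Union>k\<in>{a..b}. cycles {1..n} k). p ^ card F)"
    by (rule sum.UNION_disjoint[symmetric]) (use card in \<open>auto simp: finite_cycles\<close>)
  finally show ?thesis .
qed

text \<open>If the largest component is smaller than \<open>a\<close>, all cycles with length from
  \<open>a\<close> to \<open>b\<close> are absent, and Janson's inequality applies to them. Here
  \<open>\<epsilon>\<close> bounds the correlation, \<open>\<beta>\<close> controls the expectation,
  and \<open>2 \<le> a\<close> excludes loops.\<close>

lemma prob_largest_scc_size_less:
  fixes p c \<beta> \<epsilon> :: real
  assumes p: "0 \<le> p" "p \<le> 1" and ab: "2 \<le> a" "b \<le> n"
    and c: "real n * p \<le> c" "1 \<le> c" "c ^ b \<le> 2"
    and \<epsilon>: "6 * real b ^ 3 * p \<le> \<epsilon>" "\<epsilon> \<le> 1"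
    and \<beta>: "\<And>k. k \<in> {a..b} \<Longrightarrow> \<beta> \<le> (real n * p) ^ k * (1 - real k ^ 2 / real n)"
  shows "measure_pmf.prob (random_digraph n p) {G. largest_scc_size (with_proj G) < a}
    \<le> exp (- (1 - \<epsilon>) * (\<beta> * (\<Sum>k=a..b. 1 / real k)))"
proof -
  define \<F> where "\<F> = (\<Union>k\<in>{a..b}. cycles {1..n} k)"
  define M where "M = Pi_pmf (possible_arcs n) False (\<lambda>_. bernoulli_pmf p)"
  define graph where "graph = (\<lambda>X. \<lparr>pverts = {1..n}, parcs = {a \<in> possible_arcs n. X a}\<rparr>)"
  have fin: "finite (possible_arcs n)"
    by (rule finite_subset[of _ "{1..n} \<times> {1..n}"]) (auto simp: possible_arcs_def)
  have cycle: "\<exists>xs. distinct xs \<and> set xs \<subseteq> {1..n} \<and> a \<le> length xs \<and> F = cycle_arcs xs" if F: "F \<in> \<F>" for F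
    using F unfolding \<F>_def cycles_def by auto
  have sub: "F \<subseteq> possible_arcs n" if "F \<in> \<F>" for F
    using cycle[OF that] cycle_arcs_subset_possible_arcs ab by fastforce
  have absent: "\<not> (\<forall>e\<in>F. X e)" if small: "largest_scc_size (with_proj (graph X)) < a" and F: "F \<in> \<F>" for X F
  proof
    assume present: "\<forall>e\<in>F. X e"
    obtain xs where xs: "distinct xs" "set xs \<subseteq> {1..n}" "a \<le> length xs" "F = cycle_arcs xs"
      using cycle[OF F] by blast
    have "length xs \<le> largest_scc_size (with_proj (graph X))"
    proof (rule length_cycle_le_largest_scc_size)
      show "cycle_arcs xs \<subseteq> parcs (graph X)"
        using present sub[OF F] xs(4) by (auto simp: graph_def)
      show "parcs (graph X) \<subseteq> pverts (graph X) \<times> pverts (graph X)"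
        by (auto simp: graph_def possible_arcs_def)
    qed (use xs in \<open>simp_all add: graph_def\<close>)
    with small xs(3) show False by simp
  qed
  have "measure_pmf.prob (random_digraph n p) {G. largest_scc_size (with_proj G) < a} =
      measure_pmf.prob M {X. largest_scc_size (with_proj (graph X)) < a}"
    by (simp add: random_digraph_def M_def graph_def vimage_def)
  also have "\<dots> \<le> measure_pmf.prob M {X. \<forall>F\<in>\<F>. \<not> (\<forall>e\<in>F. X e)}"
    using absent by (intro measure_pmf.finite_measure_mono) auto
  also have "\<dots> \<le> exp (- (1 - 6 * real b ^ 3 * p) * (\<Sum>F\<in>\<F>. p ^ card F))"
    unfolding M_def
  proof (rule Janson_inequality[OF fin p])
    show "finite \<F>"
      by (auto simp: \<F>_def finite_cycles)
    show "F \<subseteq> possible_arcs n" if "F \<in> \<F>" for F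
      by (rule sub[OF that])
    show "(\<Sum>F'\<in>{F'\<in>\<F>. F' \<noteq> F \<and> F' \<inter> F \<noteq> {}}. p ^ card (F \<union> F')) \<le> 6 * real b ^ 3 * p * p ^ card F"
      if "F \<in> \<F>" for F
    proof (rule cycle_neighbour_sum[where V = "{1..n}" and c = c])
      show "\<F> \<subseteq> (\<Union>k\<in>{2..b}. cycles {1..n} k)"
        using ab by (force simp: \<F>_def)
    qed (use that p c \<epsilon> in auto)
  qed
  also have "\<dots> \<le> exp (- (1 - \<epsilon>) * (\<beta> * (\<Sum>k=a..b. 1 / real k)))"
  proof -
    have "(1 - \<epsilon>) * (\<beta> * (\<Sum>k=a..b. 1 / real k)) \<le> (1 - \<epsilon>) * (\<Sum>F\<in>\<F>. p ^ card F)"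
      unfolding \<F>_def using assms by (intro mult_left_mono cycle_weight_ge) auto
    also have "\<dots> \<le> (1 - 6 * real b ^ 3 * p) * (\<Sum>F\<in>\<F>. p ^ card F)"
      using \<epsilon> p by (intro mult_right_mono sum_nonneg) auto
    finally show ?thesis
      unfolding exp_le_cancel_iff mult_minus_left by (rule le_imp_neg_le)
  qed
  finally show ?thesis .
qed

theorem theorem1p4:
  fixes \<delta> l :: real
  assumes "0 < \<delta>" and "\<delta> < 1 / 800"
    and "l \<noteq> 0 \<longrightarrow> \<delta> \<le> (ln 2)\<^sup>2 / (4 * \<bar>l\<bar>\<^sup>2)"
  shows "\<exists>N::nat. \<forall>n\<ge>N.
    measure_pmf.prob (random_digraph n (1 / real n + l * real n powr (- 4 / 3)))
      {G. real (largest_scc_size (with_proj G)) < \<delta> * real n powr (1 / 3)}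
    \<le> 2 * exp 1 * \<delta> powr (1 / 4)"
proof -
  \<comment> \<open>Threshold for \<open>t = n powr (1 / 3)\<close>: 100 makes
    \<open>1 - k ^ 2 / n\<close> at least 99/100, \<open>2 * \<bar>l\<bar>\<close> keeps
    \<open>n * p\<close> within 1/2 of 1, and \<open>2 / \<delta>\<close> makes the shortest cycle
    length at least 2.\<close>
  define T where "T = max 100 (max (2 * \<bar>l\<bar>) (2 / \<delta>))"
  define s where "s = sqrt \<delta>"
  have s: "0 < s" "s * s = \<delta>" "s \<le> 1 / 28"
  proof -
    have "sqrt \<delta> \<le> sqrt ((1 / 28) ^ 2)"
      using assms(2) by (intro real_sqrt_le_mono) (simp add: power2_eq_square)
    thus "s \<le> 1 / 28"
      by (simp add: s_def)
  qed (use assms in \<open>simp_all add: s_def\<close>)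
  have ln2: "0 < ln (2 :: real)"
    by simp
  \<comment> \<open>The condition on \<open>\<delta>\<close> after taking square roots.\<close>
  have ls: "\<bar>l\<bar> * s \<le> ln 2 / 2"
  proof (cases "l = 0")
    case False
    have "(\<bar>l\<bar> * s) ^ 2 = \<delta> * \<bar>l\<bar> ^ 2"
      using s(2) by (simp add: power2_eq_square algebra_simps)
    also have "\<dots> \<le> (ln 2 / 2) ^ 2"
      using assms(3) False by (simp add: field_simps)
    finally show ?thesis
      by (rule power2_le_imp_le) simp
  qed simp
  have "filterlim (\<lambda>n. real n powr (1 / 3)) at_top sequentially"
    by real_asymp
  hence "\<forall>\<^sub>F n in sequentially. T \<le> real n powr (1 / 3)"
    by (simp add: filterlim_at_top)
  then obtain N where N: "\<And>n. n \<ge> N \<Longrightarrow> T \<le> real n powr (1 / 3)"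
    by (auto simp: eventually_sequentially)
  show ?thesis
  proof (intro exI allI impI)
    fix n assume "n \<ge> N"
    define t where "t = real n powr (1 / 3)"
    define p where "p = 1 / real n + l * real n powr (- 4 / 3)"
    define a where "a = nat \<lceil>\<delta> * t\<rceil>"
    define b where "b = nat \<lfloor>s * t\<rfloor>"
    have t: "100 \<le> t" "2 * \<bar>l\<bar> \<le> t" "2 / \<delta> \<le> t"
      using N[OF \<open>n \<ge> N\<close>] by (auto simp: T_def t_def)
    hence n: "0 < real n"
      by (cases "n = 0") (auto simp: t_def)
    have t3: "t ^ 3 = real n"
      using n by (simp add: t_def powr_powr flip: powr_numeral)
    have dt: "2 \<le> \<delta> * t"
      using t(3) assms(1) by (simp add: field_simps)
    have "real n powr (- 4 / 3) = 1 / (t * real n)"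
    proof -
      have "real n powr (- 4 / 3) = real n powr (- (1 / 3)) * real n powr (- 1)"
        unfolding powr_add[symmetric] by simp
      thus ?thesis
        using n by (simp add: t_def powr_minus field_simps)
    qed
    hence np: "real n * p = 1 + l / t"
      using n t(1) by (simp add: p_def field_simps)
    have lt: "\<bar>l / t\<bar> \<le> 1 / 2"
      using t by (simp add: field_simps)
    have np_bounds: "1 / 2 \<le> real n * p" "real n * p \<le> 2"
      using lt unfolding np by linarith+
    have tn: "t \<le> real n"
      using power_increasing[of 1 3 t] t(1) t3 by simp
    have b: "real b \<le> s * t" "s * t \<le> real b + 1"
      using s(1) t(1) of_int_floor_le[of "s * t"] floor_correct[of "s * t"] unfolding b_def by auto
    have a: "2 \<le> a" "real a \<le> 2 * (\<delta> * t)" "\<delta> * t \<le> real a"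
      using dt unfolding a_def by linarith+
    have bt: "real b * (\<bar>l\<bar> / t) \<le> ln 2 / 2"
    proof -
      have "real b * (\<bar>l\<bar> / t) \<le> s * t * (\<bar>l\<bar> / t)"
        using b t by (intro mult_right_mono) auto
      also have "\<dots> = \<bar>l\<bar> * s"
        using t by simp
      finally show ?thesis
        using ls by (rule order.trans)
    qed
    have "s * t \<le> 1 * t"
      using s t by (intro mult_right_mono) auto
    hence b_le_t: "real b \<le> t"
      using b by linarith
    have "0 < real n * p"
      using np_bounds by linarith
    hence p0: "0 \<le> p"
      using n by (simp add: zero_less_mult_iff)
    have "measure_pmf.prob (random_digraph n p) {G. largest_scc_size (with_proj G) < a}
      \<le> exp (- (1 - 1 / 100) * (3 / 5 * (\<Sum>k=a..b. 1 / real k)))"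
    \<comment> \<open>The absolute value ensures \<open>1 \<le> c\<close> for negative
      \<open>l\<close> too.\<close>
    proof (rule prob_largest_scc_size_less[where c = "1 + \<bar>l\<bar> / t"])
      show "0 \<le> p"
        by (rule p0)
      have "real n * p \<le> real n"
        using np_bounds tn t by linarith
      thus "p \<le> 1"
        using mult_le_cancel_left_pos[OF n, of p 1] by simp
      show "b \<le> n"
        using b_le_t tn by linarith
      show "real n * p \<le> 1 + \<bar>l\<bar> / t"
        unfolding np using t by (simp add: divide_right_mono)
      have "(1 + \<bar>l\<bar> / t) ^ b \<le> exp (\<bar>l\<bar> / t) ^ b"
        using t exp_ge_add_one_self[of "\<bar>l\<bar> / t"] by (intro power_mono) auto
      also have "\<dots> = exp (real b * (\<bar>l\<bar> / t))"
        by (rule exp_of_nat_mult[symmetric])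
      also have "\<dots> \<le> exp (ln 2)"
        unfolding exp_le_cancel_iff using bt ln2 by linarith
      finally show "(1 + \<bar>l\<bar> / t) ^ b \<le> 2"
        by simp
      have "6 * real b ^ 3 * p \<le> 6 * (s * t) ^ 3 * p"
        using b p0 by (intro mult_right_mono mult_left_mono power_mono) auto
      also have "\<dots> = 6 * s ^ 3 * (real n * p)"
        by (simp add: power_mult_distrib t3)
      also have "\<dots> \<le> 6 * (1 / 28) ^ 3 * 2"
        using s np_bounds by (intro mult_mono power_mono) auto
      also have "\<dots> \<le> 1 / 100"
        by (simp add: power3_eq_cube)
      finally show "6 * real b ^ 3 * p \<le> 1 / 100" .
      show "3 / 5 \<le> (real n * p) ^ k * (1 - real k ^ 2 / real n)" if k: "k \<in> {a..b}" for k
      proof -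
        have "- (real k * (l / t)) \<le> \<bar>real k * (l / t)\<bar>"
          by (rule abs_ge_minus_self)
        also have "\<dots> = real k * (\<bar>l\<bar> / t)"
          using t by (simp add: abs_mult)
        also have "\<dots> \<le> real b * (\<bar>l\<bar> / t)"
          using k t by (intro mult_right_mono) auto
        also note bt
        \<comment> \<open>With Bernoulli's inequality this gives
          \<open>(n * p) ^ k \<ge> 1 - 25 / 72\<close>.\<close>
        also have "ln 2 / 2 \<le> (25 / 72 :: real)"
          using ln2_le_25_over_36 by simp
        finally have "47 / 72 \<le> 1 + real k * (l / t)"
          by simp
        also have "\<dots> \<le> (1 + l / t) ^ k"
          using lt by (intro Bernoulli_inequality) linarith
        finally have 1: "47 / 72 \<le> (real n * p) ^ k"
          by (simp add: np)
        have "real k ^ 2 \<le> t ^ 2"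
          using k b_le_t by (intro power_mono) auto
        hence "real k ^ 2 / real n \<le> t ^ 2 / t ^ 3"
          using n by (simp add: t3 divide_right_mono)
        also have "\<dots> = 1 / t"
          using t by (simp add: power2_eq_square power3_eq_cube divide_simps)
        also have "\<dots> \<le> 1 / 100"
          using t by (simp add: field_simps)
        finally have 2: "99 / 100 \<le> 1 - real k ^ 2 / real n"
          by simp
        have "3 / 5 \<le> (47 / 72) * (99 / 100 :: real)"
          by simp
        also have "\<dots> \<le> (real n * p) ^ k * (1 - real k ^ 2 / real n)"
          using 1 2 by (intro mult_mono) auto
        finally show ?thesis .
      qed
    qed (use a t in auto)
    also have "\<dots> \<le> exp (ln 2 + 1 + ln \<delta> / 4)"
    proof -
      have "ln (s * t) \<le> ln (real b + 1)"
        using b s t by (subst ln_le_cancel_iff) auto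
      moreover have "ln (real a) \<le> ln (2 * (\<delta> * t))"
        using a assms(1) t by (subst ln_le_cancel_iff) auto
      moreover have "ln (s * t) = ln \<delta> / 2 + ln t"
        using s t assms(1) by (simp add: ln_mult s_def ln_sqrt)
      moreover have "ln (2 * (\<delta> * t)) = ln 2 + ln \<delta> + ln t"
        using t assms(1) by (simp add: ln_mult)
      ultimately have "- ln \<delta> / 2 - ln 2 \<le> (\<Sum>k=a..b. 1 / real k)"
        using harmonic_segment_ge[of a b] a(1) by simp
      moreover have "ln \<delta> < 0"
        using assms by simp
      \<comment> \<open>297/500 is 99/100 times 3/5. Half of it exceeds 1/4, so the negative
        \<open>ln \<delta>\<close> absorbs the difference.\<close>
      ultimately have "- (297 / 500) * (\<Sum>k=a..b. 1 / real k) \<le> ln 2 + 1 + ln \<delta> / 4"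
        using ln2 by linarith
      thus ?thesis
        unfolding exp_le_cancel_iff by simp
    qed
    also have "\<dots> = 2 * exp 1 * \<delta> powr (1 / 4)"
      using assms(1) by (simp add: exp_add powr_def)
    finally have "measure_pmf.prob (random_digraph n p) {G. largest_scc_size (with_proj G) < a}
      \<le> 2 * exp 1 * \<delta> powr (1 / 4)" .
    moreover have "measure_pmf.prob (random_digraph n p) {G. real (largest_scc_size (with_proj G)) < \<delta> * t}
      \<le> measure_pmf.prob (random_digraph n p) {G. largest_scc_size (with_proj G) < a}"
      using a(3) by (intro measure_pmf.finite_measure_mono) auto
    ultimately show "measure_pmf.prob (random_digraph n (1 / real n + l * real n powr (- 4 / 3)))
        {G. real (largest_scc_size (with_proj G)) < \<delta> * real n powr (1 / 3)}
      \<le> 2 * exp 1 * \<delta> powr (1 / 4)"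
      unfolding p_def t_def by linarith
  qed
qed

end
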